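(* Let $|\psi_{ABC}\rangle\in\mathbb{C}^2\otimes\mathbb{C}^2\otimes\mathbb{C}^2$ be a pure three-qubit state (a unit vector). For each pair $ij\in\{AB,BC,AC\}$, let $\rho_{ij}$ be the two-qubit reduced density matrix, let $\Lambda_{ij}$ be its $4\times 4$ real matrix parametrization, and let $\Gamma_{ij}=G\,\Lambda_{ij}\,G\,\Lambda_{ij}^T$ with $G=\mathrm{diag}(1,-1,-1,-1)$. Then the squared concurrence $C_{ij}^2$ of $\rho_{ij}$ is equal to the smallest eigenvalue $\mu^{ij}_2$ of $\Gamma_{ij}$.
   Context: Reduced states: $\rho_{AB}=\mathrm{Tr}_C|\psi_{ABC}\rangle\langle\psi_{ABC}|$, $\rho_{BC}=\mathrm{Tr}_A|\psi_{ABC}\rangle\langle\psi_{ABC}|$, $\rho_{AC}=\mathrm{Tr}_B|\psi_{ABC}\rangle\langle\psi_{ABC}|$, each a $4\times4$ density matrix on $\mathbb{C}^2\otimes\mathbb{C}^2$. Real parametrization: let $\sigma_0=I_2$ and let $\sigma_1=\begin{pmatrix}0&1\\1&0\end{pmatrix}$, $\sigma_2=\begin{pmatrix}0&-i\\ i&0\end{pmatrix}$, $\sigma_3=\begin{pmatrix}1&0\\0&-1\end{pmatrix}$ be the Pauli matrices. For a two-qubit density matrix $\rho_{ij}$, $\Lambda_{ij}$ is the $4\times4$ real matrix with entries $(\Lambda_{ij})_{\alpha\beta}=\mathrm{Tr}[\rho_{ij}(\sigma_\alpha\otimes\sigma_\beta)]$, $\alpha,\beta=0,1,2,3$. Eigenvalues: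 the eigenvalues of $\Gamma_{ij}$ are real and non-negative, and for a pure three-qubit state there are at most two distinct ones, denoted $\mu_0^{ij}=\mu_1^{ij}\ge \mu_2^{ij}=\mu_3^{ij}\ge 0$ when listed with multiplicity. Concurrence: for a two-qubit density matrix $\rho$, put $\widetilde\rho=(\sigma_2\otimes\sigma_2)\,\rho^T\,(\sigma_2\otimes\sigma_2)$ (transpose in the computational basis). The matrix $\rho\widetilde\rho$ has real non-negative eigenvalues; let $\nu_1\ge\nu_2\ge\nu_3\ge\nu_4\ge0$ be their square roots. The concurrence of $\rho$ is $C=\max\{0,\nu_1-\nu_2-\nu_3-\nu_4\}$, and $C_{ij}$ denotes the concurrence of $\rho_{ij}$. *)

theory Defs
  imports "Jordan_Normal_Form.Char_Poly" "Jordan_Normal_Form.Conjugate"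
begin

text \<open>
  The computational basis of the \<open>n\<close>-qubit space is ordered lexicographically with the first
  factor most significant: \<open>|a b c\<rangle>\<close> has index \<open>4 * a + 2 * b + c\<close> in \<open>carrier_vec 8\<close>, and
  \<open>|a b\<rangle>\<close> has index \<open>2 * a + b\<close>. The Kronecker product and the partial traces follow this order.
\<close>

definition kronecker :: "complex mat \<Rightarrow> complex mat \<Rightarrow> complex mat" where
  "kronecker A B = mat (dim_row A * dim_row B) (dim_col A * dim_col B)
     (\<lambda>(i, j). A $$ (i div dim_row B, j div dim_col B) * B $$ (i mod dim_row B, j mod dim_col B))"

definition mat_trace :: "complex mat \<Rightarrow> complex" where
  "mat_trace A = sum_list (diag_mat A)"

definition pure_density :: "complex vec \<Rightarrow> complex mat" where
  "pure_density \<psi> = mat (dim_vec \<psi>) (dim_vec \<psi>) (\<lambda>(i, j). \<psi> $ i * cnj (\<psi> $ j))"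

definition partial_trace_A :: "complex mat \<Rightarrow> complex mat" where
  "partial_trace_A M = mat 4 4 (\<lambda>(i, j). \<Sum>a<2. M $$ (4 * a + i, 4 * a + j))"

text \<open>Here \<open>i = 2 * a + c\<close>, so that \<open>a = i div 2\<close> and \<open>c = i mod 2\<close>; likewise for \<open>j\<close>.\<close>

definition partial_trace_B :: "complex mat \<Rightarrow> complex mat" where
  "partial_trace_B M = mat 4 4 (\<lambda>(i, j). \<Sum>b<2.
     M $$ (4 * (i div 2) + 2 * b + i mod 2, 4 * (j div 2) + 2 * b + j mod 2))"

definition partial_trace_C :: "complex mat \<Rightarrow> complex mat" where
  "partial_trace_C M = mat 4 4 (\<lambda>(i, j). \<Sum>c<2. M $$ (2 * i + c, 2 * j + c))"

datatype qubit_pair = AB | BC | AC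

fun reduced_state :: "qubit_pair \<Rightarrow> complex vec \<Rightarrow> complex mat" where
  "reduced_state AB \<psi> = partial_trace_C (pure_density \<psi>)"
| "reduced_state BC \<psi> = partial_trace_A (pure_density \<psi>)"
| "reduced_state AC \<psi> = partial_trace_B (pure_density \<psi>)"

definition pauli :: "nat \<Rightarrow> complex mat" where
  "pauli \<alpha> =
     [mat_of_rows_list 2 [[1, 0], [0, 1]],
      mat_of_rows_list 2 [[0, 1], [1, 0]],
      mat_of_rows_list 2 [[0, - \<i>], [\<i>, 0]],
      mat_of_rows_list 2 [[1, 0], [0, - 1]]] ! \<alpha>"

text \<open>The traces below are real for Hermitian \<open>\<rho>\<close>, so \<open>Re\<close> only changes the type.\<close>

definition Lambda_mat :: "complex mat \<Rightarrow> real mat" where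
  "Lambda_mat \<rho> = mat 4 4 (\<lambda>(\<alpha>, \<beta>). Re (mat_trace (\<rho> * kronecker (pauli \<alpha>) (pauli \<beta>))))"

definition G_mat :: "real mat" where
  "G_mat = mat 4 4 (\<lambda>(i, j). if i = j then (if i = 0 then 1 else - 1) else 0)"

definition Gamma_mat :: "complex mat \<Rightarrow> real mat" where
  "Gamma_mat \<rho> = G_mat * Lambda_mat \<rho> * G_mat * transpose_mat (Lambda_mat \<rho>)"

text \<open>
  The eigenvalues with algebraic multiplicity, in decreasing order, for a matrix all of whose
  complex eigenvalues are real; \<open>Re\<close> then only changes the type.
\<close>

definition eigenvalues_desc :: "complex mat \<Rightarrow> real list" where
  "eigenvalues_desc A =
     rev (sorted_list_of_multiset (image_mset Re (proots (char_poly A))))"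

definition mu :: "real mat \<Rightarrow> nat \<Rightarrow> real" where
  "mu \<Gamma> k = eigenvalues_desc (map_mat complex_of_real \<Gamma>) ! k"

text \<open>All complex eigenvalues are required to be real, so that a least one makes sense.\<close>

definition smallest_eigenvalue :: "real mat \<Rightarrow> real \<Rightarrow> bool" where
  "smallest_eigenvalue \<Gamma> m \<longleftrightarrow> eigenvalue \<Gamma> m \<and>
     (\<forall>k. eigenvalue (map_mat complex_of_real \<Gamma>) k \<longrightarrow> k \<in> \<real> \<and> m \<le> Re k)"

definition spin_flip :: "complex mat \<Rightarrow> complex mat" where
  "spin_flip \<rho> = kronecker (pauli 2) (pauli 2) * transpose_mat \<rho> * kronecker (pauli 2) (pauli 2)"

text \<open>For a density matrix \<open>\<rho>\<close> the eigenvalues of \<open>\<rho> * spin_flip \<rho>\<close> are real and non-negative.\<close>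

definition concurrence :: "complex mat \<Rightarrow> real" where
  "concurrence \<rho> =
     (let \<nu> = map sqrt (eigenvalues_desc (\<rho> * spin_flip \<rho>))
      in max 0 (\<nu> ! 0 - \<nu> ! 1 - \<nu> ! 2 - \<nu> ! 3))"

end

theory Submission
  imports Defs
begin

text \<open>
  A two-qubit reduced state of a pure three-qubit state has rank at most two, say
  \<open>\<rho> = u u\<^sup>* + v v\<^sup>*\<close>. Let \<open>T\<close> be the symmetric \<open>2 \<times> 2\<close> Gram matrix of \<open>u, v\<close> for the
  bilinear form \<open>\<sigma>\<^sub>2 \<otimes> \<sigma>\<^sub>2\<close>, and put \<open>t = Tr (T T\<^sup>*)\<close> and \<open>e = |det T|\<close>. Since \<open>A B\<close> and
  \<open>B A\<close> have the same nonzero eigenvalues, \<open>\<rho>\<close> times its spin flip has the eigenvalues of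
  \<open>T\<^sup>* T\<close> besides two zeros; their sum is \<open>t\<close> and their product \<open>e\<^sup>2\<close>, so the squared
  concurrence is \<open>t - 2 e\<close>. On the other side, \<open>\<Lambda> = P R P\<^sup>T\<close>, where \<open>R\<close> is the realignment of
  \<open>\<rho>\<close> and \<open>P\<^sup>T G P = 2 \<epsilon> \<otimes> \<epsilon>\<close> with \<open>\<epsilon>\<close> the antisymmetric form on the qubit space. Hence
  \<open>\<Gamma>\<close> has the characteristic polynomial of \<open>4 (\<epsilon> \<otimes> \<epsilon>) R (\<epsilon> \<otimes> \<epsilon>) R\<^sup>T\<close>, which turns out
  to be \<open>t I + 2 K \<otimes> cnj K\<close> for a traceless \<open>K\<close> with \<open>K\<^sup>2 = - (det T) I\<close>. So the eigenvalues
  of \<open>\<Gamma>\<close> are \<open>t + 2 e\<close> and \<open>t - 2 e\<close>, each twice.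
\<close>

section \<open>Characteristic polynomials and spectra\<close>

text \<open>The two sides are \<open>det (M * N)\<close> and \<open>det (N * M)\<close> for the
  block matrices \<open>M = (x I, A; B, I)\<close> and \<open>N = (I, 0; - B, x I)\<close>.\<close>

lemma char_poly_mult_commute:
  fixes A B :: "'a :: idom mat"
  assumes A: "A \<in> carrier_mat n m" and B: "B \<in> carrier_mat m n"
  shows "char_poly (A * B) * [:0, 1:] ^ m = char_poly (B * A) * [:0, 1:] ^ n"
proof -
  define x :: "'a poly" where "x = [:0, 1:]"
  define c :: "'a mat \<Rightarrow> 'a poly mat" where "c = map_mat (\<lambda>a. [:a:])"
  have cA: "c A \<in> carrier_mat n m" and cB: "c B \<in> carrier_mat m n"
    using A B by (auto simp: c_def)
  interpret const: comm_ring_hom "\<lambda>a :: 'a. [:a:]"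
    by unfold_locales auto
  have AB: "c (A * B) = c A * c B" and BA: "c (B * A) = c B * c A"
    unfolding c_def using const.mat_hom_mult A B by blast+
  have cp: "char_poly_matrix D = x \<cdot>\<^sub>m 1\<^sub>m k + - c D" if "D \<in> carrier_mat k k" for D k
    using that by (intro eq_matI) (auto simp: char_poly_matrix_def x_def c_def)
  have cpAB: "char_poly_matrix (A * B) = x \<cdot>\<^sub>m 1\<^sub>m n + - (c A * c B)"
    and cpBA: "char_poly_matrix (B * A) = - (c B * c A) + x \<cdot>\<^sub>m 1\<^sub>m m"
    using cp[of "A * B" n] cp[of "B * A" m] A B cA cB
    by (auto simp: AB BA comm_add_mat[of _ m m])
  have 0: "c B + - c B = 0\<^sub>m m n" "x \<cdot>\<^sub>m - c B + x \<cdot>\<^sub>m c B = 0\<^sub>m m n"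
    "c A * (x \<cdot>\<^sub>m 1\<^sub>m m) = x \<cdot>\<^sub>m c A" "(x \<cdot>\<^sub>m 1\<^sub>m m) * c B = x \<cdot>\<^sub>m c B"
    "- c B * (x \<cdot>\<^sub>m 1\<^sub>m n) = x \<cdot>\<^sub>m - c B"
    using cA cB
    by (auto simp: mult_smult_distrib[of _ _ _ _ m] mult_smult_distrib[of _ _ _ _ n]
        mult_smult_assoc_mat[of _ m m])
  define M where "M = four_block_mat (x \<cdot>\<^sub>m 1\<^sub>m n) (c A) (c B) (1\<^sub>m m)"
  define N where "N = four_block_mat (1\<^sub>m n) (0\<^sub>m n m) (- c B) (x \<cdot>\<^sub>m 1\<^sub>m m)"
  have M: "M \<in> carrier_mat (n + m) (n + m)" and N: "N \<in> carrier_mat (n + m) (n + m)"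
    unfolding M_def N_def using cA cB by auto
  \<comment> \<open>\<open>M * N\<close> and \<open>N * M\<close> are both block upper triangular.\<close>
  have "M * N = four_block_mat (char_poly_matrix (A * B)) (x \<cdot>\<^sub>m c A) (0\<^sub>m m n) (x \<cdot>\<^sub>m 1\<^sub>m m)"
    unfolding M_def N_def
    apply (subst mult_four_block_mat[of _ n n _ m _ m _ _ n _ m])
    using cA cB A B by (auto simp: cpAB 0)
  then have 1: "det M * det N = char_poly (A * B) * x ^ m"
    using det_mult[OF M N] cA A B
    by (simp add: det_four_block_mat_lower_left_zero[of _ n _ m] char_poly_def)
  have "N * M = four_block_mat (x \<cdot>\<^sub>m 1\<^sub>m n) (c A) (0\<^sub>m m n) (char_poly_matrix (B * A))"
    unfolding M_def N_def
    apply (subst mult_four_block_mat[of _ n n _ m _ m _ _ n _ m])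
    using cA cB A B by (auto simp: cpBA 0)
  then have 2: "det N * det M = char_poly (B * A) * x ^ n"
    using det_mult[OF N M] cA A B
    by (simp add: det_four_block_mat_lower_left_zero[of _ n _ m] char_poly_def mult.commute)
  from 1 2 show ?thesis by (simp add: mult.commute x_def)
qed

lemma eigenvalues_desc_eqI:
  assumes "char_poly A = (\<Prod>x\<leftarrow>xs. [:- complex_of_real x, 1:])" and "sorted (rev xs)"
  shows "eigenvalues_desc A = xs"
proof -
  have "proots (char_poly A) = (\<Sum>x\<leftarrow>xs. {#complex_of_real x#})"
    unfolding assms(1)
  proof (induction xs)
    case (Cons a xs)
    have "(\<Prod>x\<leftarrow>xs. [:- complex_of_real x, 1:]) \<noteq> 0"
      by (auto simp: prod_list_zero_iff)
    then have "proots ([:- complex_of_real a, 1:] * (\<Prod>x\<leftarrow>xs. [:- complex_of_real x, 1:]))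
      = proots [:- complex_of_real a, 1:] + proots (\<Prod>x\<leftarrow>xs. [:- complex_of_real x, 1:])"
      by (intro proots_mult) auto
    with Cons show ?case by (simp del: mult_pCons_left)
  qed simp
  also have "image_mset Re \<dots> = mset xs"
    by (induction xs) auto
  finally show ?thesis
    using assms(2) by (simp add: eigenvalues_desc_def properties_for_sort[of "rev xs"])
qed

lemma poly_linear_factors_eq_0_iff:
  fixes k :: complex
  shows "poly (\<Prod>x\<leftarrow>xs. [:- complex_of_real x, 1:]) k = 0 \<longleftrightarrow> k \<in> complex_of_real ` set xs"
  by (induction xs) (auto simp del: mult_pCons_left simp: algebra_simps)

text \<open>Side conditions on dimensions, unlike \<open>carrier_mat\<close> premises, leave no
  sizes to guess, so the simplifier can reassociate products.\<close>

lemma assoc_mult_mat_dim: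
  fixes A B C :: "'a :: semiring_0 mat"
  assumes "dim_col A = dim_row B" "dim_col B = dim_row C"
  shows "A * B * C = A * (B * C)"
  using assms by (intro assoc_mult_mat) auto

lemma transpose_mult_dim:
  fixes A B :: "'a :: comm_semiring_0 mat"
  assumes "dim_col A = dim_row B"
  shows "transpose_mat (A * B) = transpose_mat B * transpose_mat A"
  using assms by (intro transpose_mult) auto

lemmas mult_mat_assoc_simps = assoc_mult_mat_dim transpose_mult_dim
  index_mult_mat(2,3) index_transpose_mat(2,3) transpose_transpose carrier_mat_def mem_Collect_eq

lemma less_4_cases: "(i :: nat) < 4 \<longleftrightarrow> i = 0 \<or> i = 1 \<or> i = 2 \<or> i = 3"
  by auto

lemma mat4_eqI:
  assumes "\<forall>i\<in>{0, 1, 2, 3}. \<forall>j\<in>{0, 1, 2, 3}. f (i, j) = g (i, j)"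
  shows "mat 4 4 f = mat 4 4 g"
  using assms by (intro eq_matI) (auto simp: less_4_cases)

lemma mult_mat4:
  "mat n 4 f * mat 4 m g = mat n m (\<lambda>(i, j). f (i, 0) * g (0, j) + f (i, 1) * g (1, j)
     + f (i, 2) * g (2, j) + f (i, 3) * g (3, j))"
  by (intro eq_matI) (auto simp: scalar_prod_def numeral_eq_Suc algebra_simps)

lemma mult_mat2:
  "mat n 2 f * mat 2 m g = mat n m (\<lambda>(i, j). f (i, 0) * g (0, j) + f (i, 1) * g (1, j))"
  by (intro eq_matI) (auto simp: scalar_prod_def numeral_eq_Suc algebra_simps)

lemma char_poly_mat2:
  fixes f :: "nat \<times> nat \<Rightarrow> complex"
  shows "char_poly (mat 2 2 f) =
    [:f (0, 0) * f (1, 1) - f (0, 1) * f (1, 0), - (f (0, 0) + f (1, 1)), 1:]"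
  unfolding char_poly_def char_poly_matrix_def
  apply (subst laplace_expansion_column[of _ 2 0], simp, simp)
  apply (simp add: numeral_2_eq_2 cofactor_def)
  apply (subst det_single, simp add: mat_delete_def)+
  by (simp add: mat_delete_def)

lemma mat_trace_mat4: "mat_trace (mat 4 4 f) = f (0, 0) + f (1, 1) + f (2, 2) + f (3, 3)"
  by (simp add: mat_trace_def diag_mat_def upt_conv_Cons numeral_2_eq_2 numeral_3_eq_3)

lemma transpose_mat_mat: "transpose_mat (mat n m f) = mat m n (\<lambda>(i, j). f (j, i))"
  by auto

lemma scalar_prod_vec4:
  "vec 4 f \<bullet> vec 4 g = f 0 * g 0 + f 1 * g 1 + f 2 * g 2 + f 3 * g 3"
  by (simp add: scalar_prod_def numeral_eq_Suc)

section \<open>Pauli coordinates and realignment\<close>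

lemma pauli_eq_mat:
  "pauli 0 = mat 2 2 (\<lambda>(i, j). [[1, 0], [0, 1]] ! i ! j)"
  "pauli (Suc 0) = mat 2 2 (\<lambda>(i, j). [[0, 1], [1, 0]] ! i ! j)"
  "pauli 2 = mat 2 2 (\<lambda>(i, j). [[0, - \<i>], [\<i>, 0]] ! i ! j)"
  "pauli 3 = mat 2 2 (\<lambda>(i, j). [[1, 0], [0, - 1]] ! i ! j)"
  by (simp_all add: pauli_def mat_of_rows_list_def numeral_eq_Suc)

text \<open>Row \<open>\<alpha>\<close> lists the entries of the transpose of \<open>\<sigma>\<^sub>\<alpha>\<close>, as traces pair \<open>\<rho>\<close> with transposes.\<close>

definition pauli_map :: "complex mat" where
  "pauli_map = mat 4 4 (\<lambda>(\<alpha>, k).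
     [[1, 0, 0, 1], [0, 1, 1, 0], [0, \<i>, - \<i>, 0], [1, 0, 0, - 1]] ! \<alpha> ! k)"

text \<open>The row index becomes (row, column) of the first qubit, the column index that of the second.\<close>

definition realign :: "complex mat \<Rightarrow> complex mat" where
  "realign \<rho> = mat 4 4 (\<lambda>(i, j). \<rho> $$ (2 * (i div 2) + j div 2, 2 * (i mod 2) + j mod 2))"

text \<open>Splitting the indices of the state into qubit parts turns the trace into a bilinear form
  in the transposed Pauli matrices, with matrix \<open>realign\<close>.\<close>

lemma trace_pauli:
  assumes "\<alpha> < 4" "\<beta> < 4"
  shows "mat_trace (mat 4 4 f * kronecker (pauli \<alpha>) (pauli \<beta>)) =
    (pauli_map * realign (mat 4 4 f) * transpose_mat pauli_map) $$ (\<alpha>, \<beta>)"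
  using assms unfolding less_4_cases
  apply (elim disjE)
  apply (simp_all only:)
  apply (simp_all add: kronecker_def pauli_eq_mat)
  apply (simp_all only: mult_mat4 mat_trace_mat4)
  apply (simp_all add: pauli_eq_mat)
  apply (simp_all add: pauli_map_def realign_def transpose_mat_mat)
  apply (simp_all add: mult_mat4)
  apply (simp_all add: scalar_prod_vec4)
  apply (simp_all add: algebra_simps numeral_2_eq_2 numeral_3_eq_3)
  done

text \<open>A product of two Hermitian matrices has real trace, so \<open>Re\<close> in
  \<open>Lambda_mat\<close> loses nothing.\<close>

lemma cnj_trace_pauli:
  assumes "\<alpha> < 4" "\<beta> < 4" and f: "\<And>i j. cnj (f (i, j)) = f (j, i)"
  shows "cnj (mat_trace (mat 4 4 f * kronecker (pauli \<alpha>) (pauli \<beta>))) =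
    mat_trace (mat 4 4 f * kronecker (pauli \<alpha>) (pauli \<beta>))"
  using assms(1,2) unfolding less_4_cases
  apply (elim disjE)
  apply (simp_all only:)
  apply (simp_all add: kronecker_def pauli_eq_mat)
  apply (simp_all only: mult_mat4 mat_trace_mat4)
  apply (simp_all add: pauli_eq_mat f)
  done

lemma Lambda_mat_eq:
  assumes "\<And>i j. cnj (f (i, j)) = f (j, i)"
  shows "map_mat complex_of_real (Lambda_mat (mat 4 4 f)) =
    pauli_map * realign (mat 4 4 f) * transpose_mat pauli_map"
proof (rule eq_matI)
  fix \<alpha> \<beta>
  assume "\<alpha> < dim_row (pauli_map * realign (mat 4 4 f) * transpose_mat pauli_map)"
    and "\<beta> < dim_col (pauli_map * realign (mat 4 4 f) * transpose_mat pauli_map)"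
  then have \<alpha>\<beta>: "\<alpha> < 4" "\<beta> < 4"
    by (auto simp: pauli_map_def)
  have "complex_of_real (Re z) = z" if "cnj z = z" for z
    using that by (auto simp: complex_eq_iff)
  then show "map_mat complex_of_real (Lambda_mat (mat 4 4 f)) $$ (\<alpha>, \<beta>) =
      (pauli_map * realign (mat 4 4 f) * transpose_mat pauli_map) $$ (\<alpha>, \<beta>)"
    using \<alpha>\<beta> cnj_trace_pauli[OF \<alpha>\<beta>, of f] assms trace_pauli[OF \<alpha>\<beta>, of f]
    by (simp add: Lambda_mat_def)
qed (auto simp: Lambda_mat_def pauli_map_def)

text \<open>In Pauli coordinates the quadratic form of \<open>G_mat\<close> is four times the
  determinant of a 2x2 matrix; the right side is its symmetric matrix.\<close>

lemma transpose_pauli_map_G_mat_pauli_map: "transpose_mat pauli_map * map_mat complex_of_real G_mat * pauli_map =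
   mat 4 4 (\<lambda>(i, j). [[0, 0, 0, 2], [0, 0, -2, 0], [0, -2, 0, 0], [2, 0, 0, 0]] ! i ! j)" (is "?l = mat 4 4 ?f")
proof (rule eq_matI)
  fix i j assume "i < dim_row (mat 4 4 ?f)" "j < dim_col (mat 4 4 ?f)"
  then have "i < 4" "j < 4" by auto
  have G: "map_mat complex_of_real G_mat = mat 4 4 (\<lambda>(i, j). if i = j then (if i = 0 then 1 else - 1) else 0)"
    by (auto simp: G_mat_def)
  show "?l $$ (i, j) = mat 4 4 ?f $$ (i, j)"
    using \<open>i < 4\<close> \<open>j < 4\<close> unfolding less_4_cases
    by (elim disjE) (simp_all add: transpose_mat_mat pauli_map_def G mult_mat4)
qed (auto simp: pauli_map_def)

section \<open>Rank-two states and the characteristic polynomial of \<open>Gamma_mat\<close>\<close>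

text \<open>With total functions instead of vectors, the entry function is Hermitian at all indices,
  as \<open>Lambda_mat_eq\<close> requires.\<close>

definition outer_sum :: "(nat \<Rightarrow> complex) \<Rightarrow> (nat \<Rightarrow> complex) \<Rightarrow> complex mat" where
  "outer_sum u v = mat 4 4 (\<lambda>(i, j). u i * cnj (u j) + v i * cnj (v j))"

text \<open>\<open>u\<^sup>T (\<sigma>\<^sub>2 \<otimes> \<sigma>\<^sub>2) v\<close>; then \<open>flip_trace\<close> and \<open>flip_det\<close> are the numbers \<open>t\<close> and \<open>e\<close> above.\<close>

definition flip_form :: "(nat \<Rightarrow> complex) \<Rightarrow> (nat \<Rightarrow> complex) \<Rightarrow> complex" where
  "flip_form u v = u 1 * v 2 + u 2 * v 1 - u 0 * v 3 - u 3 * v 0"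

definition flip_trace :: "(nat \<Rightarrow> complex) \<Rightarrow> (nat \<Rightarrow> complex) \<Rightarrow> real" where
  "flip_trace u v = (cmod (flip_form u u))\<^sup>2 + 2 * (cmod (flip_form u v))\<^sup>2
    + (cmod (flip_form v v))\<^sup>2"

definition flip_det :: "(nat \<Rightarrow> complex) \<Rightarrow> (nat \<Rightarrow> complex) \<Rightarrow> real" where
  "flip_det u v = cmod (flip_form u u * flip_form v v - (flip_form u v)\<^sup>2)"

text \<open>By Cayley-Hamilton a traceless 2x2 matrix squares to minus its determinant. Hence
  \<open>?A * ?D - ?B * ?C\<close> is \<open>?q\<close> times the identity, with determinant
  \<open>?q\<^sup>2\<close>.\<close>

lemma char_poly_tensor_traceless:
  fixes s x y z x' y' z' :: "'a :: idom"
  defines "K \<equiv> \<lambda>i j. [[x, y], [z, - x]] ! i ! j" and "L \<equiv> \<lambda>i j. [[x', y'], [z', - x']] ! i ! j"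
  shows "char_poly (mat 4 4 (\<lambda>(i, j). (if i = j then s else 0)
      + 2 * K (i div 2) (j div 2) * L (i mod 2) (j mod 2))) =
    ([:- s, 1:]\<^sup>2 - [:4 * (x\<^sup>2 + y * z) * (x'\<^sup>2 + y' * z'):])\<^sup>2" (is "char_poly ?M = ?q\<^sup>2")
proof -
  \<comment> \<open>All four blocks are polynomials in \<open>L\<close>, so they commute.\<close>
  define blk :: "'a poly \<Rightarrow> 'a \<Rightarrow> 'a poly mat" where
    "blk p k = mat 2 2 (\<lambda>(i, j). (if i = j then p else 0) - [:2 * k * L i j:])" for p k
  have blk: "blk p k \<in> carrier_mat 2 2" for p k
    by (simp add: blk_def)
  let ?A = "blk [:- s, 1:] x" and ?B = "blk 0 y" and ?C = "blk 0 z" and ?D = "blk [:- s, 1:] (- x)"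
  have "char_poly_matrix ?M = four_block_mat ?A ?B ?C ?D"
  proof (rule eq_matI)
    fix i j
    assume "i < dim_row (four_block_mat ?A ?B ?C ?D)" "j < dim_col (four_block_mat ?A ?B ?C ?D)"
    then have "i < 4" "j < 4" by (auto simp: blk_def)
    then show "char_poly_matrix ?M $$ (i, j) = four_block_mat ?A ?B ?C ?D $$ (i, j)"
      unfolding less_4_cases
      by (elim disjE) (simp_all add: char_poly_matrix_def blk_def four_block_mat_def Let_def K_def)
  qed (auto simp: char_poly_matrix_def blk_def)
  moreover have "?C * ?D = ?D * ?C"
    by (rule eq_matI) (auto simp: blk_def mult_mat2 less_2_cases_iff L_def algebra_simps)
  moreover have "?A * ?D - ?B * ?C = ?q \<cdot>\<^sub>m 1\<^sub>m 2"
    by (rule eq_matI)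
      (auto simp: blk_def mult_mat2 less_2_cases_iff L_def algebra_simps power2_eq_square)
  ultimately show ?thesis
    by (simp add: char_poly_def det_four_block_mat[OF blk blk blk blk])
qed

text \<open>Reading \<open>u\<close>, \<open>v\<close> as 2x2 matrices \<open>U\<close>,
  \<open>V\<close>, the realignment is \<open>U \<otimes> cnj U + V \<otimes> cnj V\<close>. Put
  \<open>X = \<epsilon> U \<epsilon> V\<^sup>T\<close> and
  \<open>Y = \<epsilon> V \<epsilon> U\<^sup>T\<close>. Then \<open>X + Y\<close> is
  \<open>flip_form u v\<close> times the identity and \<open>X - Y\<close> is the traceless matrix
  with entries \<open>x\<close>, \<open>y\<close>, \<open>z\<close>. The terms in \<open>U\<close>
  alone or \<open>V\<close> alone are scalar because
  \<open>U \<epsilon> U\<^sup>T = det U \<epsilon>\<close>.\<close>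

lemma realign_flip:
  fixes u v :: "nat \<Rightarrow> complex"
  defines "Q \<equiv> mat 4 4 (\<lambda>(i, j). [[0, 0, 0, 2], [0, 0, -2, 0], [0, -2, 0, 0], [2, 0, 0, 0]] ! i ! j)"
    and "x \<equiv> u 2 * v 1 - u 3 * v 0 + u 0 * v 3 - u 1 * v 2"
    and "y \<equiv> 2 * (u 2 * v 3 - u 3 * v 2)" and "z \<equiv> 2 * (u 1 * v 0 - u 0 * v 1)"
  shows "Q * realign (outer_sum u v) * Q * transpose_mat (realign (outer_sum u v)) =
    mat 4 4 (\<lambda>(i, j). (if i = j then complex_of_real (flip_trace u v) else 0)
      + 2 * [[x, y], [z, - x]] ! (i div 2) ! (j div 2)
          * [[cnj x, cnj y], [cnj z, - cnj x]] ! (i mod 2) ! (j mod 2))"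
proof -
  define r where "r i j = u i * cnj (u j) + v i * cnj (v j)" for i j
  have R: "realign (outer_sum u v) = mat 4 4 (\<lambda>(i, j). [[r 0 0, r 0 1, r 1 0, r 1 1],
     [r 0 2, r 0 3, r 1 2, r 1 3], [r 2 0, r 2 1, r 3 0, r 3 1], [r 2 2, r 2 3, r 3 2, r 3 3]] ! i ! j)"
    by (rule eq_matI) (auto simp: realign_def outer_sum_def r_def less_4_cases)
  \<comment> \<open>Turns the moduli in \<open>flip_trace\<close> into products, so every entry
    becomes a polynomial identity in \<open>u\<close>, \<open>v\<close> and their
    conjugates.\<close>
  have nsq: "(complex_of_real (cmod w))\<^sup>2 = w * cnj w" for w
    using complex_norm_square[of w] by simp
  show ?thesis
    unfolding Q_def R mult_mat4 transpose_mat_mat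
    apply (rule mat4_eqI)
    apply (simp add: flip_trace_def)
    apply (simp only: r_def x_def y_def z_def flip_form_def One_nat_def nsq complex_cnj_add
        complex_cnj_diff complex_cnj_mult complex_cnj_numeral complex_cnj_minus complex_cnj_cnj
        of_real_numeral)
    apply (intro conjI)
    apply (simp_all add: algebra_simps)
    done
qed

lemma char_poly_Gamma_mat:
  fixes u v :: "nat \<Rightarrow> complex"
  defines "t \<equiv> flip_trace u v" and "e \<equiv> flip_det u v"
  shows "char_poly (map_mat complex_of_real (Gamma_mat (outer_sum u v))) =
    ([:- complex_of_real t, 1:]\<^sup>2 - [:4 * (complex_of_real e)\<^sup>2:])\<^sup>2"
proof -
  define x y z d where "x = u 2 * v 1 - u 3 * v 0 + u 0 * v 3 - u 1 * v 2"
    and "y = 2 * (u 2 * v 3 - u 3 * v 2)" and "z = 2 * (u 1 * v 0 - u 0 * v 1)"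
    and "d = flip_form u u * flip_form v v - (flip_form u v)\<^sup>2"
  define P R G where "P = pauli_map" and "R = realign (outer_sum u v)"
    and "G = map_mat complex_of_real G_mat"
  note defs = P_def R_def G_def
  have dims: "dim_row P = 4" "dim_col P = 4" "dim_row R = 4" "dim_col R = 4"
    "dim_row G = 4" "dim_col G = 4"
    by (auto simp: defs pauli_map_def realign_def G_mat_def)
  define L where "L = Lambda_mat (outer_sum u v)"
  have L: "L \<in> carrier_mat 4 4" by (simp add: Lambda_mat_def L_def)
  have G: "G_mat \<in> carrier_mat 4 4" by (simp add: G_mat_def)
  have "map_mat complex_of_real L = P * R * transpose_mat P"
    unfolding L_def defs outer_sum_def by (rule Lambda_mat_eq) simp
  moreover have "map_mat complex_of_real (Gamma_mat (outer_sum u v)) =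
    G * map_mat complex_of_real L * G * transpose_mat (map_mat complex_of_real L)"
    unfolding Gamma_mat_def G_def L_def[symmetric] map_mat_transpose using L G
    by (simp add: of_real_hom.mat_hom_mult[of _ 4 4 _ 4])
  \<comment> \<open>The last factor is split off to be moved to the front, where both copies of
    \<open>G\<close> appear inside \<open>P\<^sup>T G P\<close>.\<close>
  ultimately have "map_mat complex_of_real (Gamma_mat (outer_sum u v)) =
      (G * P * R * transpose_mat P * G * P * transpose_mat R) * transpose_mat P"
    by (simp only: mult_mat_assoc_simps dims)
  moreover have "G * P * R * transpose_mat P * G * P * transpose_mat R \<in> carrier_mat 4 4"
      "transpose_mat P \<in> carrier_mat 4 4"
    by (simp_all only: mult_mat_assoc_simps dims)
  ultimately have "char_poly (map_mat complex_of_real (Gamma_mat (outer_sum u v))) =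
      char_poly (transpose_mat P * (G * P * R * transpose_mat P * G * P * transpose_mat R))"
    using char_poly_mult_commute[of "G * P * R * transpose_mat P * G * P * transpose_mat R" 4 4 "transpose_mat P"]
    by (simp del: assoc_mult_mat mult_carrier_mat)
  also have "transpose_mat P * (G * P * R * transpose_mat P * G * P * transpose_mat R) =
      (transpose_mat P * G * P) * R * (transpose_mat P * G * P) * transpose_mat R"
    by (simp only: mult_mat_assoc_simps dims)
  also note realign_flip[of u v, folded transpose_pauli_map_G_mat_pauli_map, folded defs x_def y_def z_def]
  also note char_poly_tensor_traceless
  finally have "char_poly (map_mat complex_of_real (Gamma_mat (outer_sum u v))) =
    ([:- complex_of_real t, 1:]\<^sup>2
      - [:4 * (x\<^sup>2 + y * z) * ((cnj x)\<^sup>2 + cnj y * cnj z):])\<^sup>2"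
    unfolding t_def .
  moreover have xyz: "x\<^sup>2 + y * z = - d"
    by (simp add: x_def y_def z_def d_def flip_form_def power2_eq_square algebra_simps)
  moreover have "(cnj x)\<^sup>2 + cnj y * cnj z = - cnj d"
    using arg_cong[OF xyz, of cnj] by simp
  moreover have "4 * - d * - cnj d = 4 * (complex_of_real e)\<^sup>2"
    using complex_norm_square[of d] by (simp add: e_def flip_det_def flip: d_def)
  ultimately show ?thesis by (simp only:)
qed

section \<open>Concurrence of a rank-two state\<close>

text \<open>With \<open>W\<close> having columns \<open>u\<close>, \<open>v\<close> and
  \<open>V\<close> its adjoint, moving \<open>W\<close> to the end leaves \<open>cnj T * T\<close>.
  As \<open>T\<close> is symmetric, this has trace \<open>t\<close> and determinant
  \<open>e\<^sup>2\<close>.\<close>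

lemma char_poly_mult_spin_flip:
  fixes u v :: "nat \<Rightarrow> complex"
  defines "t \<equiv> flip_trace u v" and "e \<equiv> flip_det u v"
  shows "char_poly (outer_sum u v * spin_flip (outer_sum u v)) =
    [:0, 1:]\<^sup>2 * [:(complex_of_real e)\<^sup>2, - complex_of_real t, 1:]"
proof -
  define W where "W = mat 4 2 (\<lambda>(i, j). [u i, v i] ! j)"
  define V where "V = mat 2 4 (\<lambda>(i, j). [cnj (u j), cnj (v j)] ! i)"
  define S where "S = kronecker (pauli 2) (pauli 2)"
  have S: "S = mat 4 4 (\<lambda>(i, j). [[0, 0, 0, - 1], [0, 0, 1, 0], [0, 1, 0, 0], [- 1, 0, 0, 0]] ! i ! j)"
    unfolding S_def
    by (rule eq_matI) (auto simp: kronecker_def pauli_eq_mat less_4_cases)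
  have dims: "dim_row W = 4" "dim_col W = 2" "dim_row V = 2" "dim_col V = 4"
    "dim_row S = 4" "dim_col S = 4"
    by (auto simp: W_def V_def S)
  have rho: "outer_sum u v = W * V"
    unfolding W_def V_def mult_mat2 by (auto simp: outer_sum_def)
  have T: "transpose_mat W * S * W = mat 2 2 (\<lambda>(i, j).
      [[flip_form u u, flip_form u v], [flip_form u v, flip_form v v]] ! i ! j)"
    unfolding W_def S transpose_mat_mat mult_mat4
    by (rule eq_matI) (auto simp: less_2_cases_iff flip_form_def algebra_simps)
  have T': "V * S * transpose_mat V = mat 2 2 (\<lambda>(i, j).
      [[cnj (flip_form u u), cnj (flip_form u v)], [cnj (flip_form u v), cnj (flip_form v v)]] ! i ! j)"
    unfolding V_def S transpose_mat_mat mult_mat4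
    by (rule eq_matI) (auto simp: less_2_cases_iff flip_form_def algebra_simps)
  have cp: "char_poly ((V * S * transpose_mat V) * (transpose_mat W * S * W)) =
      [:(complex_of_real e)\<^sup>2, - complex_of_real t, 1:]"
    unfolding T T' mult_mat2 char_poly_mat2 e_def t_def flip_det_def flip_trace_def of_real_add of_real_mult
      complex_norm_square of_real_power[symmetric]
    by (simp add: algebra_simps power2_eq_square)
  have "outer_sum u v * spin_flip (outer_sum u v) = W * (V * (S * (transpose_mat V * transpose_mat W) * S))"
    unfolding rho spin_flip_def S_def[symmetric]
    by (simp only: mult_mat_assoc_simps dims)
  moreover have "V * (S * (transpose_mat V * transpose_mat W) * S) * W
    = (V * S * transpose_mat V) * (transpose_mat W * S * W)"
    by (simp only: mult_mat_assoc_simps dims)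
  ultimately have "char_poly (outer_sum u v * spin_flip (outer_sum u v)) * [:0, 1:]\<^sup>2 =
      char_poly ((V * S * transpose_mat V) * (transpose_mat W * S * W)) * [:0, 1:] ^ 4"
    using char_poly_mult_commute[of W 4 2 "V * (S * (transpose_mat V * transpose_mat W) * S)"]
    by (simp only: mult_mat_assoc_simps dims)
  also note cp
  \<comment> \<open>Two of the four factors cancel against the left side; the other two give the
    double eigenvalue 0.\<close>
  also have "[:(complex_of_real e)\<^sup>2, - complex_of_real t, 1:] * [:0, 1:] ^ 4 =
      [:0, 1:]\<^sup>2 * [:(complex_of_real e)\<^sup>2, - complex_of_real t, 1:] * [:0, 1:]\<^sup>2"
    by (simp add: power4_eq_xxxx power2_eq_square mult_ac del: mult_pCons_left mult_pCons_right)
  finally show ?thesis by (subst (asm) mult_cancel_right) auto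
qed

text \<open>The nonzero candidates \<open>p\<close>, \<open>q\<close> are the roots of
  \<open>X\<^sup>2 - t X + e\<^sup>2\<close>, and
  \<open>(sqrt p - sqrt q)\<^sup>2 = p + q - 2 * sqrt (p * q)\<close>.\<close>

lemma concurrence_outer_sum:
  fixes u v :: "nat \<Rightarrow> complex"
  defines "t \<equiv> flip_trace u v" and "e \<equiv> flip_det u v"
  shows "(concurrence (outer_sum u v))\<^sup>2 = t - 2 * e"
proof -
  have e0: "e \<ge> 0" by (simp add: e_def flip_det_def)
  \<comment> \<open>Triangle inequality and AM-GM give \<open>2 * e \<le> t\<close>, which makes the
    discriminant non-negative.\<close>
  have "e \<le> cmod (flip_form u u) * cmod (flip_form v v) + (cmod (flip_form u v))\<^sup>2"
    unfolding e_def flip_det_def by (metis norm_mult norm_power norm_triangle_ineq4)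
  then have et: "2 * e \<le> t"
    unfolding t_def flip_trace_def
    using sum_squares_bound[of "cmod (flip_form u u)" "cmod (flip_form v v)"] by linarith
  then have "(2 * e)\<^sup>2 \<le> t\<^sup>2" using e0 by (intro power_mono) auto
  then have s: "0 \<le> t\<^sup>2 - 4 * e\<^sup>2" by (simp add: power_mult_distrib)
  define s where "s = sqrt (t\<^sup>2 - 4 * e\<^sup>2)"
  have s2: "s\<^sup>2 = t\<^sup>2 - 4 * e\<^sup>2" and s0: "s \<ge> 0"
    using s by (simp_all add: s_def)
  have st: "s \<le> t"
    by (rule power2_le_imp_le) (use s2 et e0 in auto)
  define p q where "p = (t + s) / 2" and "q = (t - s) / 2"
  have "p * q = (t\<^sup>2 - s\<^sup>2) / 4"
    unfolding p_def q_def by (simp add: power2_eq_square algebra_simps)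
  then have pq: "p + q = t" "p * q = e\<^sup>2" "q \<le> p" "0 \<le> q"
    using s2 s0 st by (simp_all add: p_def q_def flip: add_divide_distrib)
  have "char_poly (outer_sum u v * spin_flip (outer_sum u v)) =
      (\<Prod>x\<leftarrow>[p, q, 0, 0]. [:- complex_of_real x, 1:])"
    unfolding char_poly_mult_spin_flip t_def[symmetric] e_def[symmetric] pq(1)[symmetric]
      of_real_power[symmetric] pq(2)[symmetric]
    by (simp add: power2_eq_square algebra_simps)
  then have "eigenvalues_desc (outer_sum u v * spin_flip (outer_sum u v)) = [p, q, 0, 0]"
    by (rule eigenvalues_desc_eqI) (use pq in auto)
  then have "concurrence (outer_sum u v) = sqrt p - sqrt q"
    using pq by (simp add: concurrence_def)
  moreover have "sqrt p * sqrt q = e"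
    using pq e0 by (simp add: real_sqrt_mult[symmetric])
  ultimately show ?thesis
    using pq by (simp add: power2_diff)
qed

section \<open>Ordered eigenvalues of \<open>Gamma_mat\<close>\<close>

lemma mu_Gamma_mat_outer_sum:
  fixes u v :: "nat \<Rightarrow> complex"
  defines "t \<equiv> flip_trace u v" and "e \<equiv> flip_det u v"
  shows "mu (Gamma_mat (outer_sum u v)) 2 = t - 2 * e"
    and "smallest_eigenvalue (Gamma_mat (outer_sum u v)) (t - 2 * e)"
proof -
  let ?\<Gamma> = "Gamma_mat (outer_sum u v)"
  have e0: "e \<ge> 0" by (simp add: e_def flip_det_def)
  have \<Gamma>: "?\<Gamma> \<in> carrier_mat 4 4"
    by (auto simp: Gamma_mat_def G_mat_def Lambda_mat_def)
  have cp: "char_poly (map_mat complex_of_real ?\<Gamma>) =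
      (\<Prod>x\<leftarrow>[t + 2 * e, t + 2 * e, t - 2 * e, t - 2 * e]. [:- complex_of_real x, 1:])"
    unfolding char_poly_Gamma_mat t_def[symmetric] e_def[symmetric]
    by (simp add: power2_eq_square algebra_simps)
  \<comment> \<open>Counting from 0, index 2 is the first entry of the lower pair.\<close>
  show "mu ?\<Gamma> 2 = t - 2 * e"
    unfolding mu_def using eigenvalues_desc_eqI[OF cp] e0 by simp
  have root: "poly (char_poly (map_mat complex_of_real ?\<Gamma>)) k = 0 \<longleftrightarrow>
      k = complex_of_real (t + 2 * e) \<or> k = complex_of_real (t - 2 * e)" for k
    unfolding cp poly_linear_factors_eq_0_iff by auto
  have "eigenvalue ?\<Gamma> (t - 2 * e)"
    using \<Gamma> root[of "complex_of_real (t - 2 * e)"]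
    by (simp add: eigenvalue_root_char_poly of_real_hom.char_poly_hom
        del: of_real_diff of_real_add of_real_mult)
  moreover have "k = complex_of_real (t + 2 * e) \<or> k = complex_of_real (t - 2 * e)"
    if "eigenvalue (map_mat complex_of_real ?\<Gamma>) k" for k
    using that \<Gamma> eigenvalue_root_char_poly[of "map_mat complex_of_real ?\<Gamma>" 4 k] root by simp
  ultimately show "smallest_eigenvalue ?\<Gamma> (t - 2 * e)"
    unfolding smallest_eigenvalue_def using e0 by fastforce
qed

section \<open>Reduced states of three qubits\<close>

text \<open>\<open>u\<close> and \<open>v\<close> are the unnormalised slices of the state at the
  values 0 and 1 of the traced-out qubit.\<close>

lemma reduced_state_eq_outer_sum:
  assumes "\<psi> \<in> carrier_vec 8"
  obtains u v where "reduced_state ij \<psi> = outer_sum u v"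
proof -
  have sum2: "(\<Sum>a<2. f a) = f 0 + f 1" for f :: "nat \<Rightarrow> complex"
    by (simp add: numeral_2_eq_2)
  show ?thesis
  proof (cases ij)
    case AB
    have "reduced_state ij \<psi> = outer_sum (\<lambda>i. \<psi> $ (2 * i)) (\<lambda>i. \<psi> $ (2 * i + 1))"
      using assms AB by (auto simp: partial_trace_C_def pure_density_def outer_sum_def sum2)
    then show ?thesis by (rule that)
  next
    case BC
    have "reduced_state ij \<psi> = outer_sum (\<lambda>i. \<psi> $ i) (\<lambda>i. \<psi> $ (4 + i))"
      using assms BC by (auto simp: partial_trace_A_def pure_density_def outer_sum_def sum2)
    then show ?thesis by (rule that)
  next
    case AC
    have "reduced_state ij \<psi> = outer_sum (\<lambda>i. \<psi> $ (4 * (i div 2) + i mod 2))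
      (\<lambda>i. \<psi> $ (4 * (i div 2) + 2 + i mod 2))" (is "_ = outer_sum ?u ?v")
    proof (rule eq_matI)
      fix i j
      assume "i < dim_row (outer_sum ?u ?v)" "j < dim_col (outer_sum ?u ?v)"
      then have ij: "i < 4" "j < 4"
        by (auto simp: outer_sum_def)
      \<comment> \<open>Keeps the indices inside dimension 8, so that the entries of
        \<open>pure_density\<close> can be evaluated.\<close>
      have bound: "4 * (i div 2) + 2 * b + i mod 2 < 8" if "i < 4" "b < 2" for i b :: nat
        using that by presburger
      show "reduced_state ij \<psi> $$ (i, j) = outer_sum ?u ?v $$ (i, j)"
        using assms AC ij bound[of i 0] bound[of i 1] bound[of j 0] bound[of j 1]
        by (simp add: partial_trace_B_def pure_density_def outer_sum_def sum2)
    qed (auto simp: AC outer_sum_def partial_trace_B_def)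
    then show ?thesis by (rule that)
  qed
qed

theorem theorem1:
  fixes \<psi> :: "complex vec" and ij :: qubit_pair
  assumes "\<psi> \<in> carrier_vec 8"
    and "\<psi> \<bullet>c \<psi> = 1"
  shows "(concurrence (reduced_state ij \<psi>))\<^sup>2 = mu (Gamma_mat (reduced_state ij \<psi>)) 2 \<and>
    smallest_eigenvalue (Gamma_mat (reduced_state ij \<psi>)) (mu (Gamma_mat (reduced_state ij \<psi>)) 2)"
proof -
  obtain u v where "reduced_state ij \<psi> = outer_sum u v"
    using assms(1) by (rule reduced_state_eq_outer_sum)
  then show ?thesis
    by (simp add: concurrence_outer_sum mu_Gamma_mat_outer_sum)
qed

end
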